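(* Let $n\ge 1$ and let $P=(p_{ij})\in\{0,1\}^{n\times n}$ be nonsingular such that the simplex $S=\mathrm{conv}\{0,p_1,\dots,p_n\}$ (where $p_1,\dots,p_n$ are the columns of $P$) is acute. Write $Q=(q_{ij})=P^{-\top}$ (the transpose of the inverse of $P$). Then for all $i,j$, \[ q_{ij}>0 \iff p_{ij}=1 \quad\text{and}\quad q_{ij}<0 \iff p_{ij}=0 .\] Moreover, defining the nonnegative matrices $C=\tfrac12(|Q|-Q)$ and $D=\tfrac12(|Q|+Q)$, where $|Q|$ denotes the matrix of entrywise absolute values of $Q$, we have $Q=D-C$, where $D$ is doubly stochastic and $C$ is row-substochastic.
   Context: A $0/1$-simplex is the convex hull of $n+1$ affinely independent points of $\{0,1\}^n$ (vertices of the unit cube $I^n=[0,1]^n$). The dihedral angle between two facets of an $n$-simplex is $\pi$ minus the angle between their inward unit normals. A simplex is acute if all its dihedral angles are less than $\pi/2$. A nonnegative matrix is doubly stochastic if all its row and column sums equal $1$, and row-substochastic if all its row sums are at most $1$. *)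

theory Defs
  imports "HOL-Analysis.Analysis"
begin

definition is_inward_unit_normal :: "'a::euclidean_space set \<Rightarrow> 'a set \<Rightarrow> 'a \<Rightarrow> bool" where
  "is_inward_unit_normal S F u \<longleftrightarrow>
     norm u = 1 \<and> (\<exists>b. S \<subseteq> {x. u \<bullet> x \<ge> b} \<and> F = S \<inter> {x. u \<bullet> x = b})"

text \<open>The description below is proper only for facets of a full-dimensional polyhedron;
  see \<open>inward_unit_normal_unique\<close>.\<close>

definition inward_unit_normal :: "'a::euclidean_space set \<Rightarrow> 'a set \<Rightarrow> 'a" where
  "inward_unit_normal S F = (THE u. is_inward_unit_normal S F u)"

lemma inward_unit_normal_unique:
  fixes S :: "'a::euclidean_space set"
  assumes "polyhedron S" and dim: "aff_dim S = int DIM('a)" and F: "F facet_of S"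
  shows "\<exists>!u. is_inward_unit_normal S F u"
proof -
  obtain a b where a: "a \<noteq> 0" "S \<subseteq> {x. a \<bullet> x \<le> b}" "F = S \<inter> {x. a \<bullet> x = b}"
    using facet_of_polyhedron[OF \<open>polyhedron S\<close> F] by metis
  have ex: "is_inward_unit_normal S F (- (a /\<^sub>R norm a))"
    unfolding is_inward_unit_normal_def
  proof (intro conjI exI[of _ "- (b / norm a)"])
    show "norm (- (a /\<^sub>R norm a)) = 1" using a(1) by simp
    show "S \<subseteq> {x. - (a /\<^sub>R norm a) \<bullet> x \<ge> - (b / norm a)}"
      using a by (auto simp: field_simps)
    show "F = S \<inter> {x. - (a /\<^sub>R norm a) \<bullet> x = - (b / norm a)}"
      using a by (auto simp: field_simps)
  qed
  have hull: "affine hull F = {x. w \<bullet> x = c}"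
    if w: "norm w = 1" and Fw: "F = S \<inter> {x. w \<bullet> x = c}" for w c
  proof -
    have w0: "w \<noteq> 0" using w by auto
    have sub: "affine hull F \<subseteq> {x. w \<bullet> x = c}"
      by (rule hull_minimal) (use Fw in \<open>auto simp: affine_hyperplane\<close>)
    have "aff_dim (affine hull F) = aff_dim {x. w \<bullet> x = c}"
      using F dim w0 by (simp add: facet_of_def)
    moreover have "affine hull F \<noteq> {}" using F by (simp add: facet_of_def)
    ultimately show ?thesis
      using sub affine_affine_hull affine_hyperplane affine_dim_equal by metis
  qed
  have "u = v" if uv: "is_inward_unit_normal S F u" "is_inward_unit_normal S F v" for u v
  proof -
    obtain b c where u: "norm u = 1" "S \<subseteq> {x. u \<bullet> x \<ge> b}" "F = S \<inter> {x. u \<bullet> x = b}"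
      and v: "norm v = 1" "S \<subseteq> {x. v \<bullet> x \<ge> c}" "F = S \<inter> {x. v \<bullet> x = c}"
      using uv unfolding is_inward_unit_normal_def by blast
    have eq: "{x. u \<bullet> x = b} = {x. v \<bullet> x = c}"
      using hull[OF u(1,3)] hull[OF v(1,3)] by simp
    have uu: "u \<bullet> u = 1" "v \<bullet> v = 1" using u(1) v(1) by (simp_all add: norm_eq_1)
    define t where "t = u \<bullet> v"
    have "u \<bullet> (b *\<^sub>R u) = b" using uu by simp
    hence 1: "v \<bullet> (b *\<^sub>R u) = c" using eq by blast
    have "u \<bullet> (b *\<^sub>R u + (v - t *\<^sub>R u)) = b"
      using uu by (simp add: inner_right_distrib inner_diff_right t_def)
    hence "v \<bullet> (b *\<^sub>R u + (v - t *\<^sub>R u)) = c" using eq by blast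
    hence "t * t = 1"
      using 1 uu by (simp add: inner_right_distrib inner_diff_right t_def inner_commute)
    hence "t = 1 \<or> t = -1" by (metis square_eq_1_iff)
    thus ?thesis
    proof
      assume "t = 1"
      hence "(u - v) \<bullet> (u - v) = 0"
        using uu by (simp add: inner_diff_left inner_diff_right t_def inner_commute)
      thus ?thesis by simp
    next
      assume t: "t = -1"
      hence "(u + v) \<bullet> (u + v) = 0"
        using uu by (simp add: inner_left_distrib inner_right_distrib t_def inner_commute)
      hence vu: "v = - u" by (simp add: add_eq_0_iff)
      have "c = - b" using 1 uu vu by simp
      hence "S \<subseteq> {x. u \<bullet> x = b}" using u(2) v(2) vu by force
      hence "S = F" using u(3) by auto
      thus ?thesis using F by (simp add: facet_of_def)
    qed
  qed
  thus ?thesis using ex by blast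
qed

definition vector_angle :: "'a::real_inner \<Rightarrow> 'a \<Rightarrow> real" where
  "vector_angle u v = arccos ((u \<bullet> v) / (norm u * norm v))"

definition dihedral_angle :: "'a::euclidean_space set \<Rightarrow> 'a set \<Rightarrow> 'a set \<Rightarrow> real" where
  "dihedral_angle S F G = pi - vector_angle (inward_unit_normal S F) (inward_unit_normal S G)"

definition acute_simplex :: "'a::euclidean_space set \<Rightarrow> bool" where
  "acute_simplex S \<longleftrightarrow>
     int DIM('a) simplex S \<and>
     (\<forall>F G. F facet_of S \<and> G facet_of S \<and> F \<noteq> G \<longrightarrow> dihedral_angle S F G < pi / 2)"

definition doubly_stochastic :: "real ^ 'n ^ 'n \<Rightarrow> bool" where
  "doubly_stochastic A \<longleftrightarrow>
     (\<forall>i j. 0 \<le> A $ i $ j) \<and> (\<forall>i. (\<Sum>j\<in>UNIV. A $ i $ j) = 1) \<and> (\<forall>j. (\<Sum>i\<in>UNIV. A $ i $ j) = 1)"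

definition row_substochastic :: "real ^ 'n ^ 'm \<Rightarrow> bool" where
  "row_substochastic A \<longleftrightarrow> (\<forall>i j. 0 \<le> A $ i $ j) \<and> (\<forall>i. (\<Sum>j\<in>UNIV. A $ i $ j) \<le> 1)"

text \<open>The library's absolute value on vectors is componentwise, hence entrywise on matrices.\<close>

lemma abs_matrix_nth: "\<bar>A :: real ^ 'n ^ 'm\<bar> $ i $ j = \<bar>A $ i $ j\<bar>"
  by (simp add: abs_vec_def)

end

theory Submission
  imports Defs
begin

text \<open>Let \<open>p\<^sub>j\<close>, \<open>q\<^sub>j\<close> be the columns of \<open>P\<close> and \<open>Q\<close>, so that \<open>q\<^sub>j \<bullet> p\<^sub>k = \<delta>\<^sub>j\<^sub>k\<close>. The facet of the
  simplex opposite \<open>p\<^sub>j\<close> has inward normal \<open>q\<^sub>j\<close>, and the facet opposite \<open>0\<close> has inward normal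
  \<open>- (\<Sum>j. q\<^sub>j)\<close>. Hence acuteness says that \<open>M = Q\<^sup>T Q\<close> has negative off-diagonal entries and
  positive row sums. As \<open>Q = P M\<close>, the entry \<open>Q\<^sub>i\<^sub>j\<close> is the sum of those \<open>M\<^sub>k\<^sub>j\<close> with \<open>P\<^sub>i\<^sub>k = 1\<close>. If
  \<open>P\<^sub>i\<^sub>j = 0\<close>, only off-diagonal entries occur; if \<open>P\<^sub>i\<^sub>j = 1\<close>, the sum is at least the full column sum of
  \<open>M\<close>. So \<open>Q\<close> is positive exactly on the support of \<open>P\<close>, and the row and column sums
  of \<open>D\<close> are the diagonal entries of \<open>Q P\<^sup>T\<close> and \<open>Q\<^sup>T P\<close>. The row sums of \<open>Q = P M\<close> are positive, which
  bounds those of \<open>C = D - Q\<close> by \<open>1\<close>.\<close>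

text \<open>A point of the larger hull is \<open>s *\<^sub>R u + (1 - s) *\<^sub>R y\<close> with
  \<open>y\<close> in \<open>convex hull B\<close>, so \<open>w\<close> exceeds \<open>b\<close>
  there by \<open>s * (w \<bullet> u - b)\<close>. This is nonnegative and vanishes only for
  \<open>s = 0\<close>, that is, on the facet.\<close>

lemma is_inward_unit_normal_opposite:
  fixes w :: "'a::euclidean_space"
  assumes "B \<noteq> {}" and u: "w \<bullet> u > b" and B: "\<And>x. x \<in> B \<Longrightarrow> w \<bullet> x = b"
  shows "is_inward_unit_normal (convex hull insert u B) (convex hull B) (w /\<^sub>R norm w)"
proof -
  have w: "w \<noteq> 0"
    using u B \<open>B \<noteq> {}\<close> by fastforce
  have hB: "w \<bullet> x = b" if "x \<in> convex hull B" for x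
  proof -
    have "convex hull B \<subseteq> {x. w \<bullet> x = b}"
      by (rule hull_minimal) (use B in \<open>auto simp: convex_hyperplane\<close>)
    thus ?thesis using that by blast
  qed
  have S: "w \<bullet> x \<ge> b \<and> (w \<bullet> x = b \<longrightarrow> x \<in> convex hull B)" if x_in: "x \<in> convex hull insert u B" for x
  proof -
    obtain s t y where st: "s \<ge> 0" "t \<ge> 0" "s + t = 1" and y: "y \<in> convex hull B"
      and x: "x = s *\<^sub>R u + t *\<^sub>R y"
      using x_in unfolding convex_hull_insert[OF \<open>B \<noteq> {}\<close>] by blast
    have t: "t = 1 - s" using st by simp
    have "w \<bullet> x - b = s * (w \<bullet> u - b)"
      using hB[OF y] by (simp add: x t inner_right_distrib algebra_simps)
    moreover have "x \<in> convex hull B" if "s = 0"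
      using that x y t by simp
    ultimately show ?thesis
      using u st(1) by (smt (verit) mult_eq_0_iff mult_nonneg_nonneg)
  qed
  have sub: "convex hull B \<subseteq> convex hull insert u B"
    by (rule hull_mono) auto
  show ?thesis
    unfolding is_inward_unit_normal_def
  proof (intro conjI exI[of _ "b / norm w"])
    show "norm (w /\<^sub>R norm w) = 1" using w by simp
    show "convex hull insert u B \<subseteq> {x. (w /\<^sub>R norm w) \<bullet> x \<ge> b / norm w}"
      using S w by (auto simp: field_simps)
    show "convex hull B = convex hull insert u B \<inter> {x. (w /\<^sub>R norm w) \<bullet> x = b / norm w}"
      using S hB sub w by (auto simp: field_simps)
  qed
qed

text \<open>Turns acuteness into a sign condition on inner products. By uniqueness of inward unit
  normals, any vector constant on a facet and larger at the opposite vertex can serve as its normal,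
  without normalisation.\<close>

lemma acute_simplex_normals:
  fixes A :: "'a::euclidean_space set"
  assumes acute: "acute_simplex (convex hull A)" and indep: "\<not> affine_dependent A"
    and uv: "u \<in> A" "v \<in> A" "u \<noteq> v"
    and w: "w \<bullet> u > b" "\<And>x. x \<in> A - {u} \<Longrightarrow> w \<bullet> x = b"
    and z: "z \<bullet> v > c" "\<And>x. x \<in> A - {v} \<Longrightarrow> z \<bullet> x = c"
  shows "w \<bullet> z < 0"
proof -
  let ?S = "convex hull A"
  let ?F = "\<lambda>u. convex hull (A - {u})"
  have facet: "?F x facet_of ?S" if "x \<in> A" "A - {x} \<noteq> {}" for x
    using that by (auto simp: facet_of_convex_hull_affine_independent[OF indep])
  have Fu: "?F u facet_of ?S" and Fv: "?F v facet_of ?S"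
    using uv by (auto intro!: facet)
  have nu: "is_inward_unit_normal ?S (?F u) (w /\<^sub>R norm w)"
    using is_inward_unit_normal_opposite[of "A - {u}" b w u] uv w by (auto simp: insert_absorb)
  have nv: "is_inward_unit_normal ?S (?F v) (z /\<^sub>R norm z)"
    using is_inward_unit_normal_opposite[of "A - {v}" c z v] uv z by (auto simp: insert_absorb)
  \<comment> \<open>The vertex \<open>u\<close> tells the two facets apart: it lies in the second,
    but off the hyperplane of the first.\<close>
  have "?F u \<subseteq> {x. w \<bullet> x = b}"
    by (rule hull_minimal) (use w in \<open>auto simp: convex_hyperplane\<close>)
  moreover have "u \<in> ?F v"
    using uv by (auto intro: hull_inc)
  ultimately have ne: "?F u \<noteq> ?F v" using w(1) by auto
  have dim: "aff_dim ?S = int DIM('a)"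
    using acute by (auto simp: acute_simplex_def aff_dim_simplex)
  have "polyhedron ?S"
    using aff_independent_finite[OF indep] by (simp add: polyhedron_convex_hull)
  note uniq = inward_unit_normal_unique[OF this dim]
  have "inward_unit_normal ?S (?F u) = w /\<^sub>R norm w" "inward_unit_normal ?S (?F v) = z /\<^sub>R norm z"
    unfolding inward_unit_normal_def
    using the1_equality[OF uniq[OF Fu] nu] the1_equality[OF uniq[OF Fv] nv] by auto
  moreover have "dihedral_angle ?S (?F u) (?F v) < pi / 2"
    using acute Fu Fv ne unfolding acute_simplex_def by blast
  ultimately have ang: "vector_angle (w /\<^sub>R norm w) (z /\<^sub>R norm z) > pi / 2"
    unfolding dihedral_angle_def by simp
  have w0: "w \<noteq> 0" "z \<noteq> 0"
    using nu nv by (auto simp: is_inward_unit_normal_def)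
  show ?thesis
  proof (rule ccontr)
    assume "\<not> w \<bullet> z < 0"
    \<comment> \<open>Cauchy-Schwarz puts the quotient into [0, 1], where \<open>arccos\<close> is
      at most \<open>pi / 2\<close>.\<close>
    moreover have "w \<bullet> z \<le> norm w * norm z" by (rule norm_cauchy_schwarz)
    ultimately have "arccos ((w \<bullet> z) / (norm w * norm z)) \<le> pi / 2"
      using w0 by (intro arccos_le_pi2) (auto simp: field_simps)
    thus False using ang w0 by (simp add: vector_angle_def field_simps)
  qed
qed

text \<open>At most n + 1 points that span affine dimension n must be distinct and affinely
  independent.\<close>

lemma aff_independent_insert_columns:
  fixes P :: "real ^ 'n ^ 'n"
  assumes "int CARD('n) simplex (convex hull (insert 0 (columns P)))"
  shows "\<not> affine_dependent (insert 0 (columns P))"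
proof -
  let ?A = "insert 0 (columns P)"
  have cols: "columns P = range (\<lambda>i. column i P)"
    by (auto simp: columns_def)
  have "aff_dim ?A = int CARD('n)"
    using aff_dim_simplex[OF assms] by (simp add: aff_dim_convex_hull)
  moreover have "card (columns P) \<le> CARD('n)"
    unfolding cols by (rule card_image_le) simp
  hence "card ?A \<le> CARD('n) + 1"
    using card_insert_le_m1[of "CARD('n) + 1" "columns P" 0] by simp
  moreover have fin: "finite ?A" unfolding cols by simp
  moreover have "aff_dim ?A \<le> int (card ?A) - 1"
    using fin by (rule aff_dim_le_card)
  ultimately show ?thesis
    by (simp add: affine_independent_iff_card)
qed

theorem theorem3p1:
  fixes P Q C D :: "real ^ 'n ^ 'n"
  assumes "\<forall>i j. P $ i $ j \<in> {0, 1}"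
    and "invertible P"
    and "acute_simplex (convex hull (insert 0 (columns P)))"
    and "Q = transpose (matrix_inv P)"
    and "C = (1 / 2) *\<^sub>R (\<bar>Q\<bar> - Q)"
    and "D = (1 / 2) *\<^sub>R (\<bar>Q\<bar> + Q)"
  shows "(\<forall>i j. (Q $ i $ j > 0 \<longleftrightarrow> P $ i $ j = 1) \<and> (Q $ i $ j < 0 \<longleftrightarrow> P $ i $ j = 0)) \<and>
         Q = D - C \<and> doubly_stochastic D \<and> row_substochastic C"
proof -
  let ?A = "insert 0 (columns P)"
  define q where "q j = column j Q" for j
  define s where "s = (\<Sum>j\<in>UNIV. q j)"
  have Qq: "Q $ i $ j = q j $ i" for i j
    by (simp add: q_def column_def)
  have RP: "matrix_inv P ** P = mat 1" and PR: "P ** matrix_inv P = mat 1"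
    using someI_ex[OF \<open>invertible P\<close>[unfolded invertible_def]] by (simp_all add: matrix_inv_def)
  have qp: "(\<Sum>i\<in>UNIV. q j $ i * P $ i $ k) = (if j = k then 1 else 0)" for j k
    using arg_cong[OF RP, of "\<lambda>A. A $ j $ k"]
    by (simp add: matrix_matrix_mult_def mat_def q_def column_def assms(4) transpose_def)
  have pq: "(\<Sum>k\<in>UNIV. P $ i $ k * q k $ l) = (if i = l then 1 else 0)" for i l
    using arg_cong[OF PR, of "\<lambda>A. A $ i $ l"]
    by (simp add: matrix_matrix_mult_def mat_def q_def column_def assms(4) transpose_def)
  have inner_col: "q j \<bullet> column k P = (if j = k then 1 else 0)" for j k
    using qp[of j k] by (simp add: inner_vec_def column_def)
  have s_col: "s \<bullet> column k P = 1" for k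
    by (simp add: s_def inner_sum_left inner_col)
  have P01: "P $ i $ j = 0 \<or> P $ i $ j = 1" for i j
    using assms(1) by auto
  have indep: "\<not> affine_dependent ?A"
    using assms(3) by (intro aff_independent_insert_columns) (simp add: acute_simplex_def)
  have colA: "column j P \<in> ?A" for j
    by (auto simp: columns_def)
  have others: "q j \<bullet> x = 0" if "x \<in> ?A - {column j P}" for x j
    using that by (auto simp: columns_def inner_col)
  \<comment> \<open>The normal \<open>- s\<close> has the value -1 on the facet opposite the origin
    and the larger value 0 at the origin.\<close>
  have s_others: "- s \<bullet> x = -1" if "x \<in> ?A - {0}" for x
    using that s_col by (auto simp: columns_def)
  have col_inj: "column j P \<noteq> column k P" if "j \<noteq> k" for j k
    using inner_col[of j j] inner_col[of j k] that by auto
  have col_nz: "column j P \<noteq> 0" for j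
    using inner_col[of j j] by auto
  have M_neg: "q j \<bullet> q k < 0" if "j \<noteq> k" for j k
    by (rule acute_simplex_normals[OF assms(3) indep colA[of j] colA[of k] col_inj[OF that] _
          others[of _ j] _ others[of _ k]])
      (simp_all add: inner_col)
  have "q j \<bullet> - s < 0" for j
    by (rule acute_simplex_normals[OF assms(3) indep colA[of j] insertI1 col_nz _
          others[of _ j] _ s_others])
      (simp_all add: inner_col)
  hence qs: "q j \<bullet> s > 0" for j by simp
  \<comment> \<open>Multiply \<open>P ** transpose Q = mat 1\<close> by \<open>Q\<close> on the
    right.\<close>
  have Q_PM: "q j $ i = (\<Sum>k\<in>UNIV. P $ i $ k * (q k \<bullet> q j))" for i j
  proof -
    have "(\<Sum>k\<in>UNIV. P $ i $ k * (q k \<bullet> q j)) = (\<Sum>k\<in>UNIV. \<Sum>l\<in>UNIV. P $ i $ k * q k $ l * q j $ l)"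
      by (simp add: inner_vec_def sum_distrib_left mult.assoc)
    also have "\<dots> = (\<Sum>l\<in>UNIV. (\<Sum>k\<in>UNIV. P $ i $ k * q k $ l) * q j $ l)"
      by (subst sum.swap) (simp add: sum_distrib_right)
    also have "\<dots> = q j $ i"
      by (simp add: pq if_distrib[of "\<lambda>x. x * _"] cong: if_cong)
    finally show ?thesis by simp
  qed
  \<comment> \<open>A one in each row supplies the nonzero term that makes the sign in
    \<open>neg\<close> strict.\<close>
  have row_nz: "\<exists>k. P $ i $ k = 1" for i
  proof (rule ccontr)
    assume "\<not> ?thesis"
    hence "P $ i $ k = 0" for k using P01 by auto
    thus False using pq[of i i] by simp
  qed
  have neg: "q j $ i < 0" if "P $ i $ j = 0" for i j
  proof -
    obtain k where k: "P $ i $ k = 1" using row_nz by blast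
    have le: "P $ i $ l * (q l \<bullet> q j) \<le> 0" for l
      using P01[of i l] M_neg[of l j] that by (cases "l = j") auto
    have "P $ i $ k * (q k \<bullet> q j) < 0"
      using k that M_neg[of k j] by (cases "k = j") auto
    hence "(\<Sum>k\<in>UNIV. P $ i $ k * (q k \<bullet> q j)) < (\<Sum>k\<in>(UNIV::'n set). 0)"
      using le by (intro sum_strict_mono_ex1) auto
    thus ?thesis by (simp add: Q_PM[symmetric])
  qed
  have pos: "q j $ i > 0" if "P $ i $ j = 1" for i j
  proof -
    \<comment> \<open>The diagonal term is kept because \<open>P $ i $ j = 1\<close>; a zero factor
      can only remove a negative term.\<close>
    have "q k \<bullet> q j \<le> P $ i $ k * (q k \<bullet> q j)" for k
      using P01[of i k] M_neg[of k j] that by (cases "k = j") auto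
    hence "(\<Sum>k\<in>UNIV. q k \<bullet> q j) \<le> q j $ i"
      unfolding Q_PM by (intro sum_mono)
    moreover have "(\<Sum>k\<in>UNIV. q k \<bullet> q j) = q j \<bullet> s"
      by (simp add: s_def inner_sum_left inner_commute[of "q j"])
    ultimately show ?thesis using qs[of j] by simp
  qed
  have row_sum: "(\<Sum>j\<in>UNIV. q j $ i) \<ge> 0" for i
  proof -
    have "(\<Sum>j\<in>UNIV. q j $ i) = (\<Sum>k\<in>UNIV. P $ i $ k * (q k \<bullet> s))"
      unfolding Q_PM by (subst sum.swap) (simp add: s_def inner_sum_right sum_distrib_left)
    also have "\<dots> \<ge> 0"
      using P01 qs by (intro sum_nonneg mult_nonneg_nonneg) (metis order_refl zero_le_one, simp add: less_imp_le)
    finally show ?thesis .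
  qed
  \<comment> \<open>The sign pattern makes the positive part of \<open>Q\<close> the entrywise
    product of \<open>P\<close> and \<open>Q\<close>.\<close>
  have D_eq: "D $ i $ j = P $ i $ j * q j $ i" for i j
    using P01[of i j] neg[of i j] pos[of i j] by (auto simp: assms(6) abs_matrix_nth Qq)
  have QDC: "Q = D - C"
    by (simp add: assms(5,6) vec_eq_iff field_simps)
  have D_nonneg: "0 \<le> D $ i $ j" and C_nonneg: "0 \<le> C $ i $ j" for i j
    by (simp_all add: assms(5,6) abs_matrix_nth)
  have D_row: "(\<Sum>j\<in>UNIV. D $ i $ j) = 1" for i
    using pq[of i i] by (simp add: D_eq)
  have D_col: "(\<Sum>i\<in>UNIV. D $ i $ j) = 1" for j
    using qp[of j j] by (simp add: D_eq mult.commute)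
  have "C $ i $ j = D $ i $ j - q j $ i" for i j
    using QDC by (simp flip: Qq)
  hence C_row: "(\<Sum>j\<in>UNIV. C $ i $ j) \<le> 1" for i
    using row_sum[of i] by (simp add: sum_subtractf D_row)
  have "(Q $ i $ j > 0 \<longleftrightarrow> P $ i $ j = 1) \<and> (Q $ i $ j < 0 \<longleftrightarrow> P $ i $ j = 0)" for i j
    using P01[of i j] neg[of i j] pos[of i j] by (auto simp: Qq)
  thus ?thesis
    using QDC D_nonneg C_nonneg D_row D_col C_row
    by (simp add: doubly_stochastic_def row_substochastic_def)
qed

end
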